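(* Let $\mathfrak{g}=\mathfrak{g}_{3.7}\oplus\mathfrak{g}_1$ be the four-dimensional real Lie algebra with basis $\mathcal{B}=\{e_1,e_2,e_3,e_4\}$ whose nonzero Lie brackets (up to skew-symmetry) are $[e_2,e_3]=e_1$, $[e_3,e_1]=e_2$, $[e_1,e_2]=e_3$. Let $\langle\cdot,\cdot\rangle$ be a pseudo-Riemannian inner product on $\mathfrak{g}$ and let $(R_{ij})$ be the matrix of its Ricci operator $\operatorname{Ric}$ in the basis $\mathcal{B}$. If $$R_{i4}=R_{4i}=0\ (i=1,2,3),\quad R_{21}=-R_{12},\quad R_{31}=-R_{13},\quad R_{32}=-R_{23},\quad R_{33}=R_{22}=R_{11},$$ then $\langle\cdot,\cdot\rangle$ is an algebraic Ricci soliton. Under these conditions, $\operatorname{Ric}=\eta I_4+D$ where $\eta=R_{33}=R_{22}=R_{11}$ and $$D=\begin{bmatrix}0&R_{12}&R_{13}&0\\-R_{12}&0&R_{23}&0\\-R_{13}&-R_{23}&0&0\\0&0&0&R_{44}-R_{11}\end{bmatrix}$$ is (the matrix in the basis $\mathcal{B}$ of) a derivation of $\mathfrak{g}$.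
   Context: A pseudo-Riemannian inner product on a real Lie algebra $\mathfrak{g}$ is a nondegenerate symmetric bilinear form $\langle\cdot,\cdot\rangle$ on $\mathfrak{g}$ (of some signature $(r,s)$). Its Levi-Civita connection $\nabla$ is defined by $2\langle\nabla_uv,w\rangle=\langle[u,v],w\rangle+\langle[w,u],v\rangle+\langle[w,v],u\rangle$; its curvature is $R_{uv}=\nabla_{[u,v]}-[\nabla_u,\nabla_v]$; its Ricci curvature $\operatorname{ric}(u,v)$ is the trace of $w\mapsto R_{uw}v$; its Ricci operator $\operatorname{Ric}$ is the endomorphism of $\mathfrak{g}$ with $\langle\operatorname{Ric}(u),v\rangle=\operatorname{ric}(u,v)$. The matrix $(R_{ij})$ of $\operatorname{Ric}$ in a basis $\{e_i\}$ is given by $\operatorname{Ric}(e_j)=\sum_iR_{ij}e_i$ (the same column convention is used for $D$). A derivation is a linear map $D:\mathfrak{g}\to\mathfrak{g}$ with $D[x,y]=[D(x),y]+[x,D(y)]$ for all $x,y$. The inner product is an algebraic Ricci soliton if $\operatorname{Ric}=\eta\,\mathrm{Id}_{\mathfrak{g}}+D$ for some $\eta\in\mathbb{R}$ and some derivation $D$ of $\mathfrak{g}$. *)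

theory Defs
  imports "HOL-Analysis.Analysis"
begin

section \<open>Pseudo-Riemannian inner products on Lie algebras over \<open>\<real>\<^sup>n\<close>\<close>

definition lie_algebra :: "(real^'n \<Rightarrow> real^'n \<Rightarrow> real^'n) \<Rightarrow> bool" where
  "lie_algebra br \<longleftrightarrow> bilinear br \<and> (\<forall>x. br x x = 0) \<and>
     (\<forall>x y z. br x (br y z) + br y (br z x) + br z (br x y) = 0)"

definition lie_derivation ::
    "(real^'n \<Rightarrow> real^'n \<Rightarrow> real^'n) \<Rightarrow> (real^'n \<Rightarrow> real^'n) \<Rightarrow> bool" where
  "lie_derivation br D \<longleftrightarrow> linear D \<and> (\<forall>x y. D (br x y) = br (D x) y + br x (D y))"

definition pseudo_inner :: "(real^'n \<Rightarrow> real^'n \<Rightarrow> real) \<Rightarrow> bool" where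
  "pseudo_inner g \<longleftrightarrow> bilinear g \<and> (\<forall>x y. g x y = g y x) \<and>
     (\<forall>x. (\<forall>y. g x y = 0) \<longrightarrow> x = 0)"

(* The definite descriptions in levi_civita and ricci_op are meaningful whenever g is a
   pseudo-Riemannian inner product and br is bilinear; see levi_civita_koszul and
   ricci_op_inner below. *)

definition levi_civita ::
    "(real^'n \<Rightarrow> real^'n \<Rightarrow> real^'n) \<Rightarrow> (real^'n \<Rightarrow> real^'n \<Rightarrow> real)
     \<Rightarrow> real^'n \<Rightarrow> real^'n \<Rightarrow> real^'n" where
  "levi_civita br g u v =
     (THE z. \<forall>w. 2 * g z w = g (br u v) w + g (br w u) v + g (br w v) u)"

(* Sign convention: R_{uv} = nabla_{[u,v]} - [nabla_u, nabla_v]. *)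
definition curvature ::
    "(real^'n \<Rightarrow> real^'n \<Rightarrow> real^'n) \<Rightarrow> (real^'n \<Rightarrow> real^'n \<Rightarrow> real)
     \<Rightarrow> real^'n \<Rightarrow> real^'n \<Rightarrow> real^'n \<Rightarrow> real^'n" where
  "curvature br g u v x =
     levi_civita br g (br u v) x
     - (levi_civita br g u (levi_civita br g v x) - levi_civita br g v (levi_civita br g u x))"

definition ricci ::
    "(real^'n \<Rightarrow> real^'n \<Rightarrow> real^'n) \<Rightarrow> (real^'n \<Rightarrow> real^'n \<Rightarrow> real)
     \<Rightarrow> real^'n \<Rightarrow> real^'n \<Rightarrow> real" where
  "ricci br g u v = trace (matrix (\<lambda>w. curvature br g u w v))"

definition ricci_op ::
    "(real^'n \<Rightarrow> real^'n \<Rightarrow> real^'n) \<Rightarrow> (real^'n \<Rightarrow> real^'n \<Rightarrow> real)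
     \<Rightarrow> real^'n \<Rightarrow> real^'n" where
  "ricci_op br g u = (THE z. \<forall>v. g z v = ricci br g u v)"

definition algebraic_ricci_soliton ::
    "(real^'n \<Rightarrow> real^'n \<Rightarrow> real^'n) \<Rightarrow> (real^'n \<Rightarrow> real^'n \<Rightarrow> real) \<Rightarrow> bool" where
  "algebraic_ricci_soliton br g \<longleftrightarrow>
     (\<exists>\<eta> D. lie_derivation br D \<and> (\<forall>x. ricci_op br g x = \<eta> *\<^sub>R x + D x))"

lemma pseudo_inner_representation:
  fixes g :: "real^'n \<Rightarrow> real^'n \<Rightarrow> real"
  assumes g: "pseudo_inner g" and \<phi>: "linear \<phi>"
  shows "\<exists>!z. \<forall>w. g z w = \<phi> w"
proof -
  have bil: "bilinear g" and nd: "\<And>x. (\<And>y. g x y = 0) \<Longrightarrow> x = 0"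
    using g by (auto simp: pseudo_inner_def)
  have lin2: "linear (g z)" for z using bil by (simp add: bilinear_def)
  have lin1: "linear (\<lambda>z. g z w)" for w using bil by (simp add: bilinear_def)
  have ext: "(\<forall>w. f w = h w) \<longleftrightarrow> (\<forall>i. f (axis i 1) = h (axis i 1))"
    if "linear f" "linear h" for f h :: "real^'n \<Rightarrow> real"
    using linear_eq_stdbasis[OF that] by (auto simp: Basis_vec_def fun_eq_iff)
  define L where "L = (\<lambda>z. \<chi> i. g z (axis i 1))"
  have L: "linear L"
    using lin1 by (auto simp: L_def linear_iff vec_eq_iff)
  have inj: "inj L"
  proof (subst linear_injective_0[OF L], intro allI impI)
    fix x assume "L x = 0"
    then have "\<forall>i. g x (axis i 1) = (\<lambda>_. 0) (axis i (1::real) :: real^'n)"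
      by (simp add: L_def vec_eq_iff)
    then have "\<forall>w. g x w = 0"
      using ext[OF lin2, of "\<lambda>_. 0"] by (simp add: linear_iff)
    then show "x = 0" using nd by blast
  qed
  have "surj L" using linear_injective_imp_surjective[OF L inj] by simp
  then obtain z where z: "L z = (\<chi> i. \<phi> (axis i 1))" by (metis surjD)
  have iff: "(\<forall>w. g y w = \<phi> w) \<longleftrightarrow> L y = L z" for y
    using ext[OF lin2 \<phi>] by (simp add: z) (simp add: L_def vec_eq_iff)
  show ?thesis
    unfolding iff using inj by (metis injD)
qed

lemma levi_civita_koszul:
  fixes br :: "real^'n \<Rightarrow> real^'n \<Rightarrow> real^'n"
  assumes g: "pseudo_inner g" and br: "bilinear br"
  shows "2 * g (levi_civita br g u v) w = g (br u v) w + g (br w u) v + g (br w v) u"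
proof -
  have bil: "bilinear g" using g by (simp add: pseudo_inner_def)
  let ?\<phi> = "\<lambda>w. (g (br u v) w + g (br w u) v + g (br w v) u) / 2"
  have "linear ?\<phi>"
    by (rule linearI)
      (simp_all add: bilinear_ladd[OF br] bilinear_lmul[OF br] bilinear_ladd[OF bil]
        bilinear_radd[OF bil] bilinear_lmul[OF bil] bilinear_rmul[OF bil] field_simps)
  from pseudo_inner_representation[OF g this]
  have "\<exists>!z. \<forall>w. 2 * g z w = g (br u v) w + g (br w u) v + g (br w v) u"
    by (simp add: field_simps)
  from theI'[OF this] show ?thesis unfolding levi_civita_def by blast
qed

lemma bilinear_levi_civita:
  fixes br :: "real^'n \<Rightarrow> real^'n \<Rightarrow> real^'n"
  assumes g: "pseudo_inner g" and br: "bilinear br"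
  shows "bilinear (levi_civita br g)"
proof -
  note K = levi_civita_koszul[OF g br]
  have bil: "bilinear g" using g by (simp add: pseudo_inner_def)
  have eqI: "a = b" if "\<And>w. 2 * g a w = 2 * g b w" for a b
  proof -
    have "g (a - b) y = 0" for y using that[of y] by (simp add: bilinear_lsub[OF bil])
    then have "a - b = 0" using g unfolding pseudo_inner_def by blast
    then show ?thesis by simp
  qed
  note bl = bilinear_ladd[OF br] bilinear_lmul[OF br] bilinear_radd[OF br]
    bilinear_rmul[OF br] bilinear_ladd[OF bil] bilinear_radd[OF bil]
    bilinear_lmul[OF bil] bilinear_rmul[OF bil]
  have scale: "2 * g (c *\<^sub>R a) w = c * (2 * g a w)" for c a w by (simp add: bl)
  have add: "2 * g (a + b) w = 2 * g a w + 2 * g b w" for a b w by (simp add: bl)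
  show ?thesis
    unfolding bilinear_def
    by (intro conjI allI linearI; rule eqI; simp only: scale add K; simp add: bl algebra_simps)
qed

lemma ricci_op_inner:
  fixes br :: "real^'n \<Rightarrow> real^'n \<Rightarrow> real^'n"
  assumes g: "pseudo_inner g" and br: "bilinear br"
  shows "g (ricci_op br g u) v = ricci br g u v"
proof -
  note lc = bilinear_levi_civita[OF g br]
  have "linear (ricci br g u)"
    by (rule linearI)
      (simp_all add: ricci_def curvature_def trace_def matrix_def bilinear_radd[OF lc]
        bilinear_rmul[OF lc] sum.distrib sum_subtractf sum_distrib_left algebra_simps)
  from theI'[OF pseudo_inner_representation[OF g this]]
  show ?thesis unfolding ricci_op_def by blast
qed

section \<open>The Lie algebra \<open>\<gg>\<^sub>3\<^sub>.\<^sub>7 \<oplus> \<gg>\<^sub>1\<close>\<close>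

(* The underlying space is real^4, with e_i the standard basis vector axis i 1. *)
definition g37_g1_bracket :: "real^4 \<Rightarrow> real^4 \<Rightarrow> real^4" where
  "g37_g1_bracket x y = vector
     [x$2 * y$3 - x$3 * y$2,
      x$3 * y$1 - x$1 * y$3,
      x$1 * y$2 - x$2 * y$1,
      0]"

lemma vector_4:
  "(vector [a, b, c, d] :: 'a::zero^4) $ 1 = a"
  "(vector [a, b, c, d] :: 'a::zero^4) $ 2 = b"
  "(vector [a, b, c, d] :: 'a::zero^4) $ 3 = c"
  "(vector [a, b, c, d] :: 'a::zero^4) $ 4 = d"
  unfolding vector_def by simp_all

lemma lie_algebra_g37_g1: "lie_algebra g37_g1_bracket"
  by (simp add: lie_algebra_def bilinear_def linear_iff g37_g1_bracket_def vec_eq_iff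
      forall_4 vector_4 algebra_simps)

lemma g37_g1_bracket_basis:
  "g37_g1_bracket (axis 2 1) (axis 3 1) = axis 1 1"
  "g37_g1_bracket (axis 3 1) (axis 1 1) = axis 2 1"
  "g37_g1_bracket (axis 1 1) (axis 2 1) = axis 3 1"
  "g37_g1_bracket (axis i 1) (axis 4 1) = 0"
  by (simp_all add: g37_g1_bracket_def vec_eq_iff forall_4 vector_4 axis_def)

end

theory Submission
  imports Defs
begin

text \<open>As \<open>ricci_op\<close> is a definite description, its linearity has to be proved
  before its matrix can be used in its place. It is inherited from the linearity of
  \<open>ricci\<close> in its first argument, since \<open>g\<close> is nondegenerate.\<close>

lemma linear_ricci_op:
  fixes br :: "real^'n \<Rightarrow> real^'n \<Rightarrow> real^'n"
  assumes g: "pseudo_inner g" and br: "bilinear br"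
  shows "linear (ricci_op br g)"
proof -
  have bil: "bilinear g" using g by (simp add: pseudo_inner_def)
  note lc = bilinear_levi_civita[OF g br]
  note Ric = ricci_op_inner[OF g br]
  have eqI: "a = b" if "\<And>v. g a v = g b v" for a b
  proof -
    have "g (a - b) v = 0" for v using that[of v] by (simp add: bilinear_lsub[OF bil])
    then have "a - b = 0" using g unfolding pseudo_inner_def by blast
    then show ?thesis by simp
  qed
  show ?thesis
    \<comment> \<open>After pairing with \<open>v\<close>, both sides are traces of curvature terms,
      and \<open>u\<close> enters each term of \<open>curvature br g u w v\<close> linearly, through
      the bracket or the connection.\<close>
    by (rule linearI; rule eqI)
      (simp_all add: Ric bilinear_ladd[OF bil] bilinear_lmul[OF bil] ricci_def curvature_def
        trace_def matrix_def bilinear_ladd[OF br] bilinear_lmul[OF br] bilinear_ladd[OF lc]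
        bilinear_lmul[OF lc] bilinear_radd[OF lc] bilinear_rmul[OF lc] sum.distrib
        sum_subtractf sum_distrib_left algebra_simps)
qed

text \<open>The bracket of \<open>\<gg>\<^sub>3\<^sub>.\<^sub>7\<close> is the cross product on \<open>\<real>\<^sup>3\<close>, for which infinitesimal rotations are
  derivations; the summand \<open>\<gg>\<^sub>1\<close> is central and misses the derived algebra, so it may be scaled.\<close>

lemma lie_derivation_g37_g1_skew:
  "lie_derivation g37_g1_bracket (\<lambda>x. (vector
      [vector [0, a, b, 0],
       vector [- a, 0, c, 0],
       vector [- b, - c, 0, 0],
       vector [0, 0, 0, d]] :: real^4^4) *v x)"
  unfolding lie_derivation_def
  by (simp add: matrix_vector_mult_def sum_4 g37_g1_bracket_def vec_eq_iff forall_4 vector_4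
      algebra_simps)

theorem theorem3p11:
  fixes g :: "real^4 \<Rightarrow> real^4 \<Rightarrow> real" and R D :: "real^4^4" and \<eta> :: real
  assumes g: "pseudo_inner g"
    and R: "R = matrix (ricci_op g37_g1_bracket g)"
    and R_4: "\<forall>i\<in>{1, 2, 3}. R$i$4 = 0 \<and> R$4$i = 0"
    and R_21: "R$2$1 = - R$1$2"
    and R_31: "R$3$1 = - R$1$3"
    and R_32: "R$3$2 = - R$2$3"
    and R_diag: "R$3$3 = R$2$2" "R$2$2 = R$1$1"
    and eta: "\<eta> = R$1$1"
    and D: "D = vector
      [vector [0, R$1$2, R$1$3, 0],
       vector [- R$1$2, 0, R$2$3, 0],
       vector [- R$1$3, - R$2$3, 0, 0],
       vector [0, 0, 0, R$4$4 - R$1$1]]"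
  shows "algebraic_ricci_soliton g37_g1_bracket g
    \<and> (\<forall>x. ricci_op g37_g1_bracket g x = \<eta> *\<^sub>R x + D *v x)
    \<and> lie_derivation g37_g1_bracket (\<lambda>x. D *v x)"
proof -
  have br: "bilinear g37_g1_bracket"
    using lie_algebra_g37_g1 by (simp add: lie_algebra_def)
  have der: "lie_derivation g37_g1_bracket (\<lambda>x. D *v x)"
    unfolding D by (rule lie_derivation_g37_g1_skew)
  \<comment> \<open>No curvature is computed: the hypotheses on \<open>R\<close> say precisely that
    subtracting \<open>\<eta>\<close> from the diagonal leaves a skew 3x3 block and the entry
    \<open>R$4$4 - R$1$1\<close>.\<close>
  have mat: "R = \<eta> *\<^sub>R mat 1 + D"
    using R_4 R_21 R_31 R_32 R_diag eta
    by (simp add: D vec_eq_iff forall_4 vector_4 mat_def)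
  have "ricci_op g37_g1_bracket g x = R *v x" for x
    unfolding R by (simp add: matrix_works linear_ricci_op[OF g br])
  then have "ricci_op g37_g1_bracket g x = \<eta> *\<^sub>R x + D *v x" for x
    unfolding mat by (simp add: matrix_vector_mult_add_rdistrib scaleR_matrix_vector_assoc[symmetric])
  with der show ?thesis
    unfolding algebraic_ricci_soliton_def by blast
qed

end
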